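(* Let $g_1,h_1$ be smooth real functions of one variable evaluated at $u+v$, and $g_2,h_2$ smooth real functions of one variable evaluated at $u-v$, such that on an open set of points $(u,v)\in\mathbb{R}^2$ one has $g_1'g_2'h_1'h_2'>0$, the differences $g_1-g_2$ and $h_1-h_2$ never vanish, and moreover $(g_1-g_2)(h_1-h_2)>0$ and $(h_1-h_2)^2g_1'g_2'\neq(g_1-g_2)^2h_1'h_2'$. Then the functions $$K=-8\,\frac{\sqrt{g_1'h_1'g_2'h_2'}\,\big((h_1-h_2)^2g_1'g_2'+(g_1-g_2)^2h_1'h_2'\big)}{(g_1-g_2)^3(h_1-h_2)^3},$$ $$\varkappa=-8\sqrt{g_1'h_1'g_2'h_2'}\,\left|\frac{(h_1-h_2)^2g_1'g_2'-(g_1-g_2)^2h_1'h_2'}{(g_1-g_2)^3(h_1-h_2)^3}\right|$$ are a solution, on this open set, of the system of partial differential equations $$\sqrt[4]{K^2-\varkappa^2}\;\Delta^h\ln(K^2-\varkappa^2)=8K,$$ $$\sqrt[4]{K^2-\varkappa^2}\;\Delta^h\ln\frac{K+\varepsilon\varkappa}{K-\varepsilon\varkappa}=4\varepsilon\varkappa,$$ where $\varepsilon=\pm1$.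
   Context: $\Delta^h=\frac{\partial^2}{\partial u^2}-\frac{\partial^2}{\partial v^2}$ is the hyperbolic Laplacian. In all formulas $g_1,h_1,g_1',h_1'$ stand for $g_1(u+v),h_1(u+v),g_1'(u+v),h_1'(u+v)$ and $g_2,h_2,g_2',h_2'$ stand for $g_2(u-v),h_2(u-v),g_2'(u-v),h_2'(u-v)$, where primes denote derivatives of functions of one variable. *)

theory Defs
  imports "HOL-Analysis.Analysis"
begin

text \<open>Smoothness of a function of one real variable. It is only meant for open sets \<open>S\<close>, where
  the two-sided derivatives below depend only on the values of \<open>f\<close> on \<open>S\<close>.\<close>

definition smooth_on :: "(real \<Rightarrow> real) \<Rightarrow> real set \<Rightarrow> bool" where
  "smooth_on f S \<longleftrightarrow> (\<forall>n. \<forall>x\<in>S. (deriv ^^ n) f differentiable (at x))"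

definition partial_u :: "(real \<times> real \<Rightarrow> real) \<Rightarrow> real \<times> real \<Rightarrow> real" where
  "partial_u F = (\<lambda>(u, v). deriv (\<lambda>s. F (s, v)) u)"

definition partial_v :: "(real \<times> real \<Rightarrow> real) \<Rightarrow> real \<times> real \<Rightarrow> real" where
  "partial_v F = (\<lambda>(u, v). deriv (\<lambda>t. F (u, t)) v)"

definition hyp_laplacian :: "(real \<times> real \<Rightarrow> real) \<Rightarrow> real \<times> real \<Rightarrow> real" where
  "hyp_laplacian F p = partial_u (partial_u F) p - partial_v (partial_v F) p"

text \<open>\<open>C\<^sup>1\<close> and \<open>C\<^sup>2\<close> regularity on an open subset of the plane: the partial derivatives exist and
  are continuous. The existence has to be required separately, because \<^const>\<open>deriv\<close> is a total
  function.\<close>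

definition C1_on :: "(real \<times> real \<Rightarrow> real) \<Rightarrow> (real \<times> real) set \<Rightarrow> bool" where
  "C1_on F U \<longleftrightarrow>
     (\<forall>(u, v)\<in>U. (\<lambda>s. F (s, v)) differentiable (at u) \<and> (\<lambda>t. F (u, t)) differentiable (at v)) \<and>
     continuous_on U (partial_u F) \<and> continuous_on U (partial_v F)"

definition C2_on :: "(real \<times> real \<Rightarrow> real) \<Rightarrow> (real \<times> real) set \<Rightarrow> bool" where
  "C2_on F U \<longleftrightarrow> C1_on F U \<and> C1_on (partial_u F) U \<and> C1_on (partial_v F) U"

text \<open>Classical solutions of the system. The arguments of the logarithms are required to be
  positive, so that the default values of \<^const>\<open>ln\<close> and of division by zero play no role and both
  logarithms are again \<open>C\<^sup>2\<close>.\<close>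

definition solves_system ::
    "(real \<times> real) set \<Rightarrow> real \<Rightarrow> (real \<times> real \<Rightarrow> real) \<Rightarrow> (real \<times> real \<Rightarrow> real) \<Rightarrow> bool" where
  "solves_system U \<epsilon> K \<kappa> \<longleftrightarrow>
     C2_on K U \<and> C2_on \<kappa> U \<and>
     (\<forall>p\<in>U.
        (K p)\<^sup>2 - (\<kappa> p)\<^sup>2 > 0 \<and>
        (K p + \<epsilon> * \<kappa> p) / (K p - \<epsilon> * \<kappa> p) > 0 \<and>
        root 4 ((K p)\<^sup>2 - (\<kappa> p)\<^sup>2) * hyp_laplacian (\<lambda>q. ln ((K q)\<^sup>2 - (\<kappa> q)\<^sup>2)) p = 8 * K p \<and>
        root 4 ((K p)\<^sup>2 - (\<kappa> p)\<^sup>2) *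
          hyp_laplacian (\<lambda>q. ln ((K q + \<epsilon> * \<kappa> q) / (K q - \<epsilon> * \<kappa> q))) p = 4 * \<epsilon> * \<kappa> p)"

definition sol_K ::
    "(real \<Rightarrow> real) \<Rightarrow> (real \<Rightarrow> real) \<Rightarrow> (real \<Rightarrow> real) \<Rightarrow> (real \<Rightarrow> real) \<Rightarrow> real \<times> real \<Rightarrow> real" where
  "sol_K g1 h1 g2 h2 = (\<lambda>(u, v).
     - 8 * (sqrt (deriv g1 (u + v) * deriv h1 (u + v) * deriv g2 (u - v) * deriv h2 (u - v)) *
        ((h1 (u + v) - h2 (u - v))\<^sup>2 * deriv g1 (u + v) * deriv g2 (u - v) +
         (g1 (u + v) - g2 (u - v))\<^sup>2 * deriv h1 (u + v) * deriv h2 (u - v)) /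
        ((g1 (u + v) - g2 (u - v)) ^ 3 * (h1 (u + v) - h2 (u - v)) ^ 3)))"

definition sol_kappa ::
    "(real \<Rightarrow> real) \<Rightarrow> (real \<Rightarrow> real) \<Rightarrow> (real \<Rightarrow> real) \<Rightarrow> (real \<Rightarrow> real) \<Rightarrow> real \<times> real \<Rightarrow> real" where
  "sol_kappa g1 h1 g2 h2 = (\<lambda>(u, v).
     - 8 * sqrt (deriv g1 (u + v) * deriv h1 (u + v) * deriv g2 (u - v) * deriv h2 (u - v)) *
       \<bar>((h1 (u + v) - h2 (u - v))\<^sup>2 * deriv g1 (u + v) * deriv g2 (u - v) -
         (g1 (u + v) - g2 (u - v))\<^sup>2 * deriv h1 (u + v) * deriv h2 (u - v)) /
        ((g1 (u + v) - g2 (u - v)) ^ 3 * (h1 (u + v) - h2 (u - v)) ^ 3)\<bar>)"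

end

theory Submission
  imports Defs
begin

text \<open>
  The formulas become simple in terms of the two functions
  \<open>a = g1' g2' / (g1 - g2)\<^sup>2\<close> and \<open>b = h1' h2' / (h1 - h2)\<^sup>2\<close>, which have the same sign. Since
  \<open>(g1 - g2) (h1 - h2) > 0\<close>, the number \<open>sqrt (a b)\<close> is the square root in the formulas divided by
  \<open>(g1 - g2) (h1 - h2)\<close>, and this gives
  \<open>K = -8 sqrt (a b) (a + b)\<close> and \<open>\<kappa> = -8 sqrt (a b) \<bar>a - b\<bar>\<close>.
  Hence \<open>K\<^sup>2 - \<kappa>\<^sup>2 = 256 (a b)\<^sup>2\<close>, its fourth root is \<open>4 sqrt (a b)\<close>, and
  \<open>(K + \<epsilon> \<kappa>) / (K - \<epsilon> \<kappa>)\<close> is \<open>a / b\<close> or \<open>b / a\<close>, according to the sign of \<open>\<epsilon> (a - b)\<close>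
  (\<open>system_terms_of_two_densities\<close>). Both logarithms are thus linear combinations of
  \<open>ln \<bar>a\<bar>\<close>, \<open>ln \<bar>b\<bar>\<close> and a constant.

  Each of \<open>a\<close> and \<open>b\<close> is the classical general solution of Liouville's equation
  \<open>\<Delta>\<^sup>h ln \<bar>a\<bar> = -8 a\<close> (\<open>liouville_equation\<close>): the hyperbolic Laplacian kills functions of
  \<open>u + v\<close> alone and of \<open>u - v\<close> alone, so only the summand \<open>-2 ln \<bar>g1 - g2\<bar>\<close> contributes. Therefore
  \<open>\<Delta>\<^sup>h ln (K\<^sup>2 - \<kappa>\<^sup>2) = -16 (a + b)\<close> and
  \<open>\<Delta>\<^sup>h ln ((K + \<epsilon> \<kappa>) / (K - \<epsilon> \<kappa>)) = -8 \<epsilon> \<bar>a - b\<bar>\<close>, and multiplication by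
  \<open>4 sqrt (a b)\<close> yields \<open>8 K\<close> and \<open>4 \<epsilon> \<kappa>\<close> (\<open>solves_system_if_liouville\<close>).

  The regularity of \<open>K\<close> and \<open>\<kappa>\<close> follows from the closure of a class of \<open>k\<close> times continuously
  differentiable functions under the operations that occur in the formulas. The absolute value is
  harmless because \<open>a - b\<close> has no zeros.
\<close>

section \<open>Partial derivatives on open sets\<close>

lemma eventually_nhds_slices:
  fixes U :: "(real \<times> real) set"
  assumes "open U" and "(u, v) \<in> U"
  shows "eventually (\<lambda>s. (s, v) \<in> U) (nhds u)" and "eventually (\<lambda>t. (u, t) \<in> U) (nhds v)"
proof -
  have "((\<lambda>s. (s, v)) \<longlongrightarrow> (u, v)) (nhds u)" "((\<lambda>t. (u, t)) \<longlongrightarrow> (u, v)) (nhds v)"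
    by (auto intro!: tendsto_intros filterlim_ident)
  with assms show "eventually (\<lambda>s. (s, v) \<in> U) (nhds u)" "eventually (\<lambda>t. (u, t) \<in> U) (nhds v)"
    by (auto dest: topological_tendstoD)
qed

text \<open>A relational form of the partial derivatives. Unlike the total operators
  \<^const>\<open>partial_u\<close> and \<^const>\<open>partial_v\<close> it includes their existence, and it follows the
  rules of one-variable calculus without a side condition on differentiability.\<close>

definition has_partials ::
    "(real \<times> real \<Rightarrow> real) \<Rightarrow> (real \<times> real \<Rightarrow> real) \<Rightarrow> (real \<times> real \<Rightarrow> real) \<Rightarrow>
      (real \<times> real) set \<Rightarrow> bool" where
  "has_partials F P Q U \<longleftrightarrow>
     (\<forall>u v. (u, v) \<in> U \<longrightarrow>
        ((\<lambda>s. F (s, v)) has_real_derivative P (u, v)) (at u) \<and>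
        ((\<lambda>t. F (u, t)) has_real_derivative Q (u, v)) (at v))"

lemma has_partials_cong:
  assumes "has_partials F P Q U" and "open V" and "V \<subseteq> U" and "\<And>p. p \<in> V \<Longrightarrow> F' p = F p"
  shows "has_partials F' P Q V"
  unfolding has_partials_def
proof (intro allI impI conjI)
  fix u v assume uv: "(u, v) \<in> V"
  have d: "((\<lambda>s. F (s, v)) has_real_derivative P (u, v)) (at u)"
    "((\<lambda>t. F (u, t)) has_real_derivative Q (u, v)) (at v)"
    using assms(1,3) uv by (auto simp: has_partials_def)
  have "eventually (\<lambda>s. F' (s, v) = F (s, v)) (nhds u)"
    using eventually_nhds_slices(1)[OF assms(2) uv] by eventually_elim (simp add: assms(4))
  then show "((\<lambda>s. F' (s, v)) has_real_derivative P (u, v)) (at u)"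
    using d(1) by (subst DERIV_cong_ev[OF refl _ refl])
  have "eventually (\<lambda>t. F' (u, t) = F (u, t)) (nhds v)"
    using eventually_nhds_slices(2)[OF assms(2) uv] by eventually_elim (simp add: assms(4))
  then show "((\<lambda>t. F' (u, t)) has_real_derivative Q (u, v)) (at v)"
    using d(2) by (subst DERIV_cong_ev[OF refl _ refl])
qed

lemma partials_eq:
  assumes "has_partials F P Q U" and "p \<in> U"
  shows "partial_u F p = P p" and "partial_v F p = Q p"
  using assms by (cases p; auto simp: has_partials_def partial_u_def partial_v_def intro: DERIV_imp_deriv)+

section \<open>Functions of two variables with continuous partial derivatives\<close>

text \<open>Continuity of \<open>F\<close> is a separate conjunct in the successor case because the mere existence of
  partial derivatives does not imply it. The existential quantifier lets the derivatives be given by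
  the formulas of the calculus rules; openness of \<open>U\<close> enters where \<open>F\<close> is replaced by a function
  that agrees with it on \<open>U\<close>, as in the passage to \<^const>\<open>partial_u\<close> and \<^const>\<open>partial_v\<close>.\<close>

primrec Ck_on :: "nat \<Rightarrow> (real \<times> real \<Rightarrow> real) \<Rightarrow> (real \<times> real) set \<Rightarrow> bool" where
  "Ck_on 0 F U \<longleftrightarrow> continuous_on U F"
| "Ck_on (Suc n) F U \<longleftrightarrow>
     continuous_on U F \<and> (\<exists>P Q. has_partials F P Q U \<and> Ck_on n P U \<and> Ck_on n Q U)"

lemma Ck_on_imp_continuous_on: "Ck_on n F U \<Longrightarrow> continuous_on U F"
  by (cases n) auto

lemma Ck_on_SucI:
  "has_partials F P Q U \<Longrightarrow> continuous_on U F \<Longrightarrow> Ck_on n P U \<Longrightarrow> Ck_on n Q U \<Longrightarrow> Ck_on (Suc n) F U"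
  by auto

lemma Ck_on_SucE:
  assumes "Ck_on (Suc n) F U"
  obtains P Q where "has_partials F P Q U" and "Ck_on n P U" and "Ck_on n Q U"
  using assms by auto

declare Ck_on.simps(2) [simp del]

lemma Ck_on_Suc_imp: "Ck_on (Suc n) F U \<Longrightarrow> Ck_on n F U"
proof (induction n arbitrary: F)
  case (Suc n)
  from Suc.prems obtain P Q where "has_partials F P Q U" "Ck_on (Suc n) P U" "Ck_on (Suc n) Q U"
    by (rule Ck_on_SucE)
  with Suc.IH show ?case
    by (intro Ck_on_SucI Ck_on_imp_continuous_on[OF Suc.prems])
qed (simp add: Ck_on_imp_continuous_on)

lemma Ck_on_cong:
  assumes "Ck_on n F U" and "open U" and "\<And>p. p \<in> U \<Longrightarrow> F' p = F p"
  shows "Ck_on n F' U"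
proof -
  have c: "continuous_on U F'"
    using Ck_on_imp_continuous_on[OF assms(1)] assms(3) by (simp cong: continuous_on_cong)
  show ?thesis
  proof (cases n)
    case (Suc m)
    with assms(1) obtain P Q where PQ: "has_partials F P Q U" "Ck_on m P U" "Ck_on m Q U"
      by (auto elim: Ck_on_SucE)
    have "has_partials F' P Q U"
      using has_partials_cong[OF PQ(1) assms(2) order_refl] assms(3) by blast
    with PQ c Suc show ?thesis by (auto intro: Ck_on_SucI)
  qed (use c in auto)
qed

lemma Ck_on_partials:
  assumes "Ck_on (Suc n) F U" and "open U"
  shows "Ck_on n (partial_u F) U" and "Ck_on n (partial_v F) U"
proof -
  from assms(1) obtain P Q where PQ: "has_partials F P Q U" "Ck_on n P U" "Ck_on n Q U"
    by (rule Ck_on_SucE)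
  show "Ck_on n (partial_u F) U" "Ck_on n (partial_v F) U"
    using Ck_on_cong[OF PQ(2) assms(2)] Ck_on_cong[OF PQ(3) assms(2)] partials_eq[OF PQ(1)]
    by blast+
qed

lemma Ck_on_imp_C1_on:
  assumes "Ck_on (Suc n) F U" and "open U"
  shows "C1_on F U"
proof -
  from assms(1) obtain P Q where PQ: "has_partials F P Q U"
    by (rule Ck_on_SucE)
  have "continuous_on U (partial_u F)" "continuous_on U (partial_v F)"
    using Ck_on_partials[OF assms] Ck_on_imp_continuous_on by blast+
  with PQ show ?thesis
    by (auto simp: C1_on_def has_partials_def real_differentiable_def)
qed

lemma Ck_on_imp_C2_on:
  assumes "Ck_on (Suc (Suc n)) F U" and "open U"
  shows "C2_on F U"
  unfolding C2_on_def
  using Ck_on_imp_C1_on[OF assms] Ck_on_partials[OF assms] Ck_on_imp_C1_on assms(2) by blast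

lemma Ck_on_const: "Ck_on n (\<lambda>p. c) U"
proof (induction n arbitrary: c)
  case (Suc n)
  have "has_partials (\<lambda>p. c) (\<lambda>p. 0) (\<lambda>p. 0) U"
    by (simp add: has_partials_def)
  then show ?case
    using Suc.IH by (intro Ck_on_SucI) auto
qed auto

lemma Ck_on_add: "Ck_on n F U \<Longrightarrow> Ck_on n G U \<Longrightarrow> Ck_on n (\<lambda>p. F p + G p) U"
proof (induction n arbitrary: F G)
  case 0
  then show ?case by (auto intro: continuous_intros)
next
  case (Suc n)
  obtain P Q P' Q' where d: "has_partials F P Q U" "has_partials G P' Q' U"
    and C: "Ck_on n P U" "Ck_on n Q U" "Ck_on n P' U" "Ck_on n Q' U"
    using Suc.prems by (elim Ck_on_SucE)
  have "has_partials (\<lambda>p. F p + G p) (\<lambda>p. P p + P' p) (\<lambda>p. Q p + Q' p) U"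
    using d unfolding has_partials_def by (auto intro!: DERIV_add)
  moreover have "continuous_on U (\<lambda>p. F p + G p)"
    using Suc.prems by (intro continuous_intros Ck_on_imp_continuous_on)
  ultimately show ?case
    using Suc.IH C by (intro Ck_on_SucI)
qed

lemma Ck_on_mult: "Ck_on n F U \<Longrightarrow> Ck_on n G U \<Longrightarrow> Ck_on n (\<lambda>p. F p * G p) U"
proof (induction n arbitrary: F G)
  case 0
  then show ?case by (auto intro: continuous_intros)
next
  case (Suc n)
  obtain P Q P' Q' where d: "has_partials F P Q U" "has_partials G P' Q' U"
    and C: "Ck_on n P U" "Ck_on n Q U" "Ck_on n P' U" "Ck_on n Q' U"
    using Suc.prems by (elim Ck_on_SucE)
  have "has_partials (\<lambda>p. F p * G p) (\<lambda>p. P p * G p + P' p * F p) (\<lambda>p. Q p * G p + Q' p * F p) U"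
    using d unfolding has_partials_def by (auto intro!: DERIV_mult)
  moreover have "continuous_on U (\<lambda>p. F p * G p)"
    using Suc.prems by (intro continuous_intros Ck_on_imp_continuous_on)
  moreover have "Ck_on n F U" "Ck_on n G U"
    using Suc.prems by (auto intro: Ck_on_Suc_imp)
  then have "Ck_on n (\<lambda>p. P p * G p + P' p * F p) U" "Ck_on n (\<lambda>p. Q p * G p + Q' p * F p) U"
    using C by (auto intro: Ck_on_add Suc.IH)
  ultimately show ?case
    by (rule Ck_on_SucI)
qed

lemma Ck_on_minus: "Ck_on n F U \<Longrightarrow> Ck_on n (\<lambda>p. - F p) U"
  using Ck_on_mult[OF Ck_on_const[of n "-1"]] by fastforce

lemma Ck_on_diff: "Ck_on n F U \<Longrightarrow> Ck_on n G U \<Longrightarrow> Ck_on n (\<lambda>p. F p - G p) U"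
  using Ck_on_add[OF _ Ck_on_minus] by fastforce

text \<open>The derivative of \<open>1 / F\<close> is a product of \<open>1 / F\<close> itself with derivatives of \<open>F\<close>, so the
  induction on the order of differentiability closes. The square root below is treated in the same
  way.\<close>

lemma Ck_on_inverse:
  assumes "\<And>p. p \<in> U \<Longrightarrow> F p \<noteq> 0"
  shows "Ck_on n F U \<Longrightarrow> Ck_on n (\<lambda>p. inverse (F p)) U"
proof (induction n)
  case 0
  then show ?case using assms by (auto intro: continuous_intros)
next
  case (Suc n)
  obtain P Q where d: "has_partials F P Q U" and C: "Ck_on n P U" "Ck_on n Q U"
    using Suc.prems by (elim Ck_on_SucE)
  let ?R = "\<lambda>P p. - (inverse (F p) * P p * inverse (F p))"
  have "has_partials (\<lambda>p. inverse (F p)) (?R P) (?R Q) U"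
    using d assms unfolding has_partials_def by (auto intro!: derivative_eq_intros)
  moreover have "continuous_on U (\<lambda>p. inverse (F p))"
    using Suc.prems assms by (intro continuous_intros Ck_on_imp_continuous_on) auto
  moreover have "Ck_on n (\<lambda>p. inverse (F p)) U"
    using Suc.IH Ck_on_Suc_imp[OF Suc.prems] .
  then have "Ck_on n (?R P) U" "Ck_on n (?R Q) U"
    using C by (auto intro!: Ck_on_mult Ck_on_minus)
  ultimately show ?case
    by (rule Ck_on_SucI)
qed

lemma Ck_on_divide:
  assumes "Ck_on n F U" and "Ck_on n G U" and "\<And>p. p \<in> U \<Longrightarrow> G p \<noteq> 0"
  shows "Ck_on n (\<lambda>p. F p / G p) U"
  unfolding divide_inverse by (intro Ck_on_mult Ck_on_inverse assms)

lemma Ck_on_sqrt: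
  assumes "\<And>p. p \<in> U \<Longrightarrow> F p > 0"
  shows "Ck_on n F U \<Longrightarrow> Ck_on n (\<lambda>p. sqrt (F p)) U"
proof (induction n)
  case 0
  then show ?case by (auto intro: continuous_intros)
next
  case (Suc n)
  obtain P Q where d: "has_partials F P Q U" and C: "Ck_on n P U" "Ck_on n Q U"
    using Suc.prems by (elim Ck_on_SucE)
  let ?R = "\<lambda>P p. (1/2) * (P p * inverse (sqrt (F p)))"
  have S: "((\<lambda>x. sqrt (f x)) has_real_derivative (1/2) * (D * inverse (sqrt (f x)))) (at x)"
    if "(f has_real_derivative D) (at x)" "f x > 0" for f D x
    using that by (auto intro!: derivative_eq_intros simp: field_simps)
  have "has_partials (\<lambda>p. sqrt (F p)) (?R P) (?R Q) U"
    unfolding has_partials_def by (intro allI impI conjI S) (use d assms in \<open>auto simp: has_partials_def\<close>)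
  moreover have "continuous_on U (\<lambda>p. sqrt (F p))"
    using Suc.prems by (intro continuous_intros Ck_on_imp_continuous_on)
  moreover have "Ck_on n (\<lambda>p. inverse (sqrt (F p))) U"
    using Suc.IH[OF Ck_on_Suc_imp[OF Suc.prems]] by (intro Ck_on_inverse) (auto dest!: assms)
  then have "Ck_on n (?R D) U" if "Ck_on n D U" for D
    by (intro Ck_on_mult Ck_on_const that)
  note this[OF C(1)] this[OF C(2)]
  ultimately show ?case
    by (rule Ck_on_SucI)
qed

text \<open>Writing \<open>\<bar>F\<bar>\<close> as \<open>sqrt (F\<^sup>2)\<close> avoids a discussion of the set on which \<open>F\<close> is positive.\<close>

lemma Ck_on_abs:
  assumes "Ck_on n F U" and "\<And>p. p \<in> U \<Longrightarrow> F p \<noteq> 0"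
  shows "Ck_on n (\<lambda>p. \<bar>F p\<bar>) U"
proof -
  have "Ck_on n (\<lambda>p. sqrt (F p * F p)) U"
    using assms by (intro Ck_on_sqrt Ck_on_mult) (auto simp: zero_less_mult_iff linorder_neq_iff)
  then show ?thesis
    by simp
qed

lemma smooth_on_has_derivative:
  assumes "smooth_on f S" and "x \<in> S"
  shows "(f has_real_derivative deriv f x) (at x)"
  using assms unfolding smooth_on_def
  by (metis DERIV_deriv_iff_real_differentiable funpow_0)

lemma smooth_on_deriv: "smooth_on f S \<Longrightarrow> smooth_on (deriv f) S"
  unfolding smooth_on_def by (metis comp_apply funpow_Suc_right)

text \<open>The slope \<open>c\<close> will be \<open>1\<close> or \<open>-1\<close>; it treats functions of \<open>u + v\<close> and of \<open>u - v\<close> at once.\<close>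

lemma DERIV_wave:
  fixes f :: "real \<Rightarrow> real"
  assumes "(f has_real_derivative D) (at (u + c * v))"
  shows "((\<lambda>s. f (s + c * v)) has_real_derivative D) (at u)"
    and "((\<lambda>t. f (u + c * t)) has_real_derivative c * D) (at v)"
proof -
  have "((\<lambda>s. s + c * v) has_real_derivative 1) (at u)" "((\<lambda>t. u + c * t) has_real_derivative c) (at v)"
    by (auto intro!: derivative_eq_intros)
  then show "((\<lambda>s. f (s + c * v)) has_real_derivative D) (at u)"
    and "((\<lambda>t. f (u + c * t)) has_real_derivative c * D) (at v)"
    using DERIV_chain2[of f D "\<lambda>s. s + c * v" u 1] DERIV_chain2[of f D "\<lambda>t. u + c * t" v c] assms
    by (simp_all add: mult.commute)
qed

lemma Ck_on_wave:
  assumes "\<And>u v. (u, v) \<in> U \<Longrightarrow> u + c * v \<in> S"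
  shows "smooth_on f S \<Longrightarrow> Ck_on n (\<lambda>(u, v). f (u + c * v)) U"
proof (induction n arbitrary: f)
  have cont: "continuous_on U (\<lambda>(u, v). f (u + c * v))" if "smooth_on f S" for f
  proof -
    have "continuous_on S f"
      using DERIV_isCont[OF smooth_on_has_derivative[OF that]] by (simp add: continuous_at_imp_continuous_on)
    moreover have "continuous_on U (\<lambda>p. fst p + c * snd p)"
      by (intro continuous_intros)
    moreover have "(\<lambda>p. fst p + c * snd p) ` U \<subseteq> S"
      using assms by auto
    ultimately have "continuous_on U (\<lambda>p. f (fst p + c * snd p))"
      by (rule continuous_on_compose2)
    then show ?thesis
      by (simp add: case_prod_unfold)
  qed
  {
    case 0
    then show ?case by (simp add: cont)
  next
    case (Suc n)
    let ?D = "\<lambda>(u, v). deriv f (u + c * v)"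
    have d: "(f has_real_derivative deriv f (u + c * v)) (at (u + c * v))" if "(u, v) \<in> U" for u v
      using smooth_on_has_derivative Suc.prems assms that by blast
    have "has_partials (\<lambda>(u, v). f (u + c * v)) ?D (\<lambda>p. c * ?D p) U"
      unfolding has_partials_def by (auto intro!: DERIV_wave d)
    moreover note cont[OF Suc.prems]
    moreover have D: "Ck_on n ?D U"
      by (rule Suc.IH[OF smooth_on_deriv[OF Suc.prems]])
    moreover have "Ck_on n (\<lambda>p. c * ?D p) U"
      by (intro Ck_on_mult Ck_on_const D)
    ultimately show ?case
      by (rule Ck_on_SucI)
  }
qed

section \<open>The hyperbolic Laplacian\<close>

text \<open>The first derivatives of \<open>F\<close> are \<open>P\<close> and \<open>Q\<close>, the pure second ones \<open>R\<close> and \<open>T\<close>, and the mixed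
  ones \<open>X\<close> and \<open>Y\<close>. As for \<^const>\<open>has_partials\<close>, their existence is part of the relation,
  which makes it linear in \<open>F\<close> and \<open>L\<close>.\<close>

definition has_hyp_laplacian ::
    "(real \<times> real \<Rightarrow> real) \<Rightarrow> (real \<times> real \<Rightarrow> real) \<Rightarrow> (real \<times> real) set \<Rightarrow> bool" where
  "has_hyp_laplacian F L U \<longleftrightarrow>
     (\<exists>P Q R X Y T. has_partials F P Q U \<and> has_partials P R X U \<and> has_partials Q Y T U \<and>
        (\<forall>p\<in>U. L p = R p - T p))"

text \<open>The Laplacian is local: agreement on an open subset \<open>V\<close> suffices. This is what permits
  replacing a locally constant sign by a constant.\<close>

lemma hyp_laplacian_eqI:
  assumes "has_hyp_laplacian F L U" and "open V" and "V \<subseteq> U"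
    and eq: "\<And>q. q \<in> V \<Longrightarrow> F' q = F q" and "p \<in> V"
  shows "hyp_laplacian F' p = L p"
proof -
  obtain P Q R X Y T where d: "has_partials F P Q U" "has_partials P R X U" "has_partials Q Y T U"
    and L: "\<forall>p\<in>U. L p = R p - T p"
    using assms(1) by (auto simp: has_hyp_laplacian_def)
  have F': "has_partials F' P Q V"
    by (rule has_partials_cong[OF d(1) assms(2,3) eq])
  have u: "has_partials (partial_u F') R X V"
    by (rule has_partials_cong[OF d(2) assms(2,3)]) (rule partials_eq(1)[OF F'])
  have v: "has_partials (partial_v F') Y T V"
    by (rule has_partials_cong[OF d(3) assms(2,3)]) (rule partials_eq(2)[OF F'])
  have "p \<in> U"
    using assms(3,5) by blast
  then show ?thesis
    by (simp add: hyp_laplacian_def partials_eq(1)[OF u assms(5)] partials_eq(2)[OF v assms(5)] L)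
qed

lemma has_hyp_laplacian_cong:
  assumes "has_hyp_laplacian F L U" and "open U"
    and F': "\<And>p. p \<in> U \<Longrightarrow> F' p = F p" and L': "\<And>p. p \<in> U \<Longrightarrow> L' p = L p"
  shows "has_hyp_laplacian F' L' U"
proof -
  obtain P Q R X Y T where d: "has_partials F P Q U" "has_partials P R X U" "has_partials Q Y T U"
    and L: "\<forall>p\<in>U. L p = R p - T p"
    using assms(1) by (auto simp: has_hyp_laplacian_def)
  have "has_partials F' P Q U"
    by (rule has_partials_cong[OF d(1) assms(2) order_refl F'])
  moreover have "\<forall>p\<in>U. L' p = R p - T p"
    using L L' by simp
  ultimately show ?thesis
    unfolding has_hyp_laplacian_def using d(2,3) by blast
qed

lemma has_hyp_laplacian_const: "has_hyp_laplacian (\<lambda>p. c) (\<lambda>p. 0) U"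
proof -
  have *: "has_partials (\<lambda>p. c) (\<lambda>p. 0) (\<lambda>p. 0) U" for c
    by (simp add: has_partials_def)
  show ?thesis
    unfolding has_hyp_laplacian_def
    by (intro exI conjI) (rule *, rule *, rule *, simp)
qed

lemma has_hyp_laplacian_add:
  assumes "has_hyp_laplacian F L U" and "has_hyp_laplacian G M U"
  shows "has_hyp_laplacian (\<lambda>p. F p + G p) (\<lambda>p. L p + M p) U"
proof -
  have *: "has_partials (\<lambda>p. F p + G p) (\<lambda>p. P p + P' p) (\<lambda>p. Q p + Q' p) U"
    if "has_partials F P Q U" "has_partials G P' Q' U" for F G P Q P' Q'
    using that unfolding has_partials_def by (auto intro!: DERIV_add)
  obtain P Q R X Y T where 1: "has_partials F P Q U" "has_partials P R X U" "has_partials Q Y T U"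
    "\<forall>p\<in>U. L p = R p - T p"
    using assms(1) by (auto simp: has_hyp_laplacian_def)
  obtain P' Q' R' X' Y' T' where 2: "has_partials G P' Q' U" "has_partials P' R' X' U"
    "has_partials Q' Y' T' U" "\<forall>p\<in>U. M p = R' p - T' p"
    using assms(2) by (auto simp: has_hyp_laplacian_def)
  have "\<forall>p\<in>U. L p + M p = (R p + R' p) - (T p + T' p)"
    using 1 2 by auto
  then show ?thesis
    unfolding has_hyp_laplacian_def using *[OF 1(1) 2(1)] *[OF 1(2) 2(2)] *[OF 1(3) 2(3)] by blast
qed

lemma has_hyp_laplacian_cmult:
  assumes "has_hyp_laplacian F L U"
  shows "has_hyp_laplacian (\<lambda>p. c * F p) (\<lambda>p. c * L p) U"
proof -
  have *: "has_partials (\<lambda>p. c * F p) (\<lambda>p. c * P p) (\<lambda>p. c * Q p) U"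
    if "has_partials F P Q U" for F P Q
    using that unfolding has_partials_def by (auto intro!: DERIV_cmult)
  obtain P Q R X Y T where 1: "has_partials F P Q U" "has_partials P R X U" "has_partials Q Y T U"
    "\<forall>p\<in>U. L p = R p - T p"
    using assms by (auto simp: has_hyp_laplacian_def)
  have "\<forall>p\<in>U. c * L p = c * R p - c * T p"
    by (simp add: 1(4) right_diff_distrib)
  then show ?thesis
    unfolding has_hyp_laplacian_def using *[OF 1(1)] *[OF 1(2)] *[OF 1(3)] by blast
qed

section \<open>Liouville's equation\<close>

text \<open>At negative arguments \<^term>\<open>ln x\<close> stands for \<open>ln \<bar>x\<bar>\<close>. This is used throughout the section,
  since the derivatives and differences inside the logarithms may have either sign. Rewriting
  \<open>ln f\<close> as \<open>ln (f\<^sup>2) / 2\<close> reduces the claim to a positive argument.\<close>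

lemma DERIV_ln_nonzero:
  fixes f :: "real \<Rightarrow> real"
  assumes "(f has_real_derivative D) (at x)" and "f x \<noteq> 0"
  shows "((\<lambda>t. ln (f t)) has_real_derivative D / f x) (at x)"
proof -
  have "f x * f x > 0"
    using assms(2) by (simp add: zero_less_mult_iff linorder_neq_iff disj_commute)
  from DERIV_cdivide[OF DERIV_chain2[OF DERIV_ln_divide[OF this] DERIV_mult[OF assms(1,1)]], of 2]
  have "((\<lambda>t. ln (f t * f t) / 2) has_real_derivative D / f x) (at x)"
    by (rule DERIV_cong) (simp add: assms(2) field_simps)
  moreover have "(\<lambda>t. ln (f t * f t) / 2) = (\<lambda>t. ln (f t))"
    by (simp add: ln_mult fun_eq_iff)
  ultimately show ?thesis
    by (simp only:)
qed

text \<open>In the coordinates \<open>x = u + v\<close>, \<open>y = u - v\<close> the Laplacian is four times the mixed second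
  derivative, and the \<open>x\<close>-derivative \<open>p' / (p - q)\<close> of the logarithm has the \<open>y\<close>-derivative
  \<open>p' q' / (p - q)\<^sup>2\<close>. The proof computes directly with \<open>u\<close> and \<open>v\<close>: the second derivatives of \<open>p\<close>
  and \<open>q\<close> enter \<open>\<partial>\<^sub>u\<^sub>u\<close> and \<open>\<partial>\<^sub>v\<^sub>v\<close> alike and cancel, leaving
  \<open>((p' + q')\<^sup>2 - (p' - q')\<^sup>2) / (p - q)\<^sup>2\<close>.\<close>

lemma has_hyp_laplacian_ln_diff:
  assumes p: "\<And>u v. (u, v) \<in> U \<Longrightarrow> (p has_real_derivative p' (u + v)) (at (u + v))"
    and p': "\<And>u v. (u, v) \<in> U \<Longrightarrow> (p' has_real_derivative p'' (u + v)) (at (u + v))"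
    and q: "\<And>u v. (u, v) \<in> U \<Longrightarrow> (q has_real_derivative q' (u - v)) (at (u - v))"
    and q': "\<And>u v. (u, v) \<in> U \<Longrightarrow> (q' has_real_derivative q'' (u - v)) (at (u - v))"
    and nz: "\<And>u v. (u, v) \<in> U \<Longrightarrow> p (u + v) - q (u - v) \<noteq> 0"
  shows "has_hyp_laplacian (\<lambda>(u, v). ln (p (u + v) - q (u - v)))
           (\<lambda>(u, v). 4 * p' (u + v) * q' (u - v) / (p (u + v) - q (u - v))\<^sup>2) U"
proof -
  \<comment> \<open>\<open>D1\<close>, \<open>D2\<close> are the first partial derivatives of \<open>D\<close>; both pure second derivatives are
    \<open>E1\<close>, and \<open>E2\<close> is the mixed one.\<close>
  define D where "D = (\<lambda>(u, v). p (u + v) - q (u - v))"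
  define D1 where "D1 = (\<lambda>(u, v). p' (u + v) - q' (u - v))"
  define D2 where "D2 = (\<lambda>(u, v). p' (u + v) + q' (u - v))"
  define E1 where "E1 = (\<lambda>(u, v). p'' (u + v) - q'' (u - v))"
  define E2 where "E2 = (\<lambda>(u, v). p'' (u + v) + q'' (u - v))"
  note w = DERIV_wave[where c = 1, simplified] and w' = DERIV_wave[where c = "-1", simplified]
  have D: "has_partials D D1 D2 U"
    unfolding has_partials_def D_def D1_def D2_def
    by (auto intro!: derivative_eq_intros w[OF p] w'[OF q])
  have D1: "has_partials D1 E1 E2 U" and D2: "has_partials D2 E2 E1 U"
    unfolding has_partials_def D1_def D2_def E1_def E2_def
    by (auto intro!: derivative_eq_intros w[OF p'] w'[OF q'])
  have D0: "D (u, v) \<noteq> 0" if "(u, v) \<in> U" for u v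
    using nz[OF that] by (simp add: D_def)
  have quot: "has_partials (\<lambda>z. N z / D z) (\<lambda>z. (N1 z * D z - N z * D1 z) / (D z * D z))
      (\<lambda>z. (N2 z * D z - N z * D2 z) / (D z * D z)) U" if "has_partials N N1 N2 U" for N N1 N2
    using that D D0 unfolding has_partials_def by (auto intro!: DERIV_divide)
  have "has_partials (\<lambda>z. ln (D z)) (\<lambda>z. D1 z / D z) (\<lambda>z. D2 z / D z) U"
    using D D0 unfolding has_partials_def by (auto intro!: DERIV_ln_nonzero)
  moreover note quot[OF D1] quot[OF D2]
  moreover have "\<forall>z\<in>U. (case z of (u, v) \<Rightarrow> 4 * p' (u + v) * q' (u - v) / (p (u + v) - q (u - v))\<^sup>2) =
      (E1 z * D z - D1 z * D1 z) / (D z * D z) - (E1 z * D z - D2 z * D2 z) / (D z * D z)"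
    unfolding D1_def D2_def D_def
    by (auto simp: diff_divide_distrib[symmetric] power2_eq_square algebra_simps)
  ultimately have "has_hyp_laplacian (\<lambda>z. ln (D z))
      (\<lambda>(u, v). 4 * p' (u + v) * q' (u - v) / (p (u + v) - q (u - v))\<^sup>2) U"
    unfolding has_hyp_laplacian_def by blast
  then show ?thesis
    by (simp add: D_def case_prod_unfold)
qed

text \<open>The general solution \<open>a\<close> of Liouville's equation \<open>\<Delta>\<^sup>h ln \<bar>a\<bar> = -8 a\<close> in terms of two
  functions of one variable; \<open>a\<close> is the conformal density \<open>e\<^sup>w\<close>, up to sign, of the usual
  unknown \<open>w\<close>.\<close>

definition liouville_solution ::
    "(real \<Rightarrow> real) \<Rightarrow> (real \<Rightarrow> real) \<Rightarrow> real \<times> real \<Rightarrow> real" where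
  "liouville_solution f g = (\<lambda>(u, v). deriv f (u + v) * deriv g (u - v) / (f (u + v) - g (u - v))\<^sup>2)"

text \<open>The logarithm splits into \<open>ln \<bar>f'\<bar> + ln \<bar>g'\<bar> - 2 ln \<bar>f - g\<bar>\<close>. The first two summands depend on
  \<open>u + v\<close> alone and on \<open>u - v\<close> alone, so their Laplacians vanish, and the third one contributes
  \<open>-2 \<cdot> 4 f' g' / (f - g)\<^sup>2\<close>.\<close>

lemma liouville_equation:
  assumes f: "smooth_on f I" and g: "smooth_on g J"
    and IJ: "\<And>u v. (u, v) \<in> U \<Longrightarrow> u + v \<in> I \<and> u - v \<in> J"
    and f0: "\<And>u v. (u, v) \<in> U \<Longrightarrow> deriv f (u + v) \<noteq> 0"
    and g0: "\<And>u v. (u, v) \<in> U \<Longrightarrow> deriv g (u - v) \<noteq> 0"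
    and nz: "\<And>u v. (u, v) \<in> U \<Longrightarrow> f (u + v) - g (u - v) \<noteq> 0"
    and U: "open U"
  shows "has_hyp_laplacian (\<lambda>p. ln (liouville_solution f g p)) (\<lambda>p. - 8 * liouville_solution f g p) U"
proof -
  note df = smooth_on_has_derivative[OF f]
    smooth_on_has_derivative[OF smooth_on_deriv[OF f]]
    smooth_on_has_derivative[OF smooth_on_deriv[OF smooth_on_deriv[OF f]]]
  note dg = smooth_on_has_derivative[OF g]
    smooth_on_has_derivative[OF smooth_on_deriv[OF g]]
    smooth_on_has_derivative[OF smooth_on_deriv[OF smooth_on_deriv[OF g]]]
  \<comment> \<open>The zeros are kept: a function of one light-cone variable is a difference with the zero
    function, and the numerator \<open>p' q'\<close> then vanishes.\<close>
  have 1: "has_hyp_laplacian (\<lambda>(u, v). ln (deriv f (u + v) - 0))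
      (\<lambda>(u, v). 4 * deriv (deriv f) (u + v) * 0 / (deriv f (u + v) - 0)\<^sup>2) U"
    by (rule has_hyp_laplacian_ln_diff[where p'' = "deriv (deriv (deriv f))"
          and q = "\<lambda>_. 0" and q' = "\<lambda>_. 0" and q'' = "\<lambda>_. 0"])
      (use df IJ f0 in auto)
  have 2: "has_hyp_laplacian (\<lambda>(u, v). ln (0 - deriv g (u - v)))
      (\<lambda>(u, v). 4 * 0 * deriv (deriv g) (u - v) / (0 - deriv g (u - v))\<^sup>2) U"
    by (rule has_hyp_laplacian_ln_diff[where q'' = "deriv (deriv (deriv g))"
          and p = "\<lambda>_. 0" and p' = "\<lambda>_. 0" and p'' = "\<lambda>_. 0"])
      (use dg IJ g0 in auto)
  have 3: "has_hyp_laplacian (\<lambda>(u, v). ln (f (u + v) - g (u - v)))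
      (\<lambda>(u, v). 4 * deriv f (u + v) * deriv g (u - v) / (f (u + v) - g (u - v))\<^sup>2) U"
    by (rule has_hyp_laplacian_ln_diff[where p'' = "deriv (deriv f)" and q'' = "deriv (deriv g)"])
      (use df dg IJ nz in auto)
  note L = has_hyp_laplacian_add[OF has_hyp_laplacian_add[OF 1 2] has_hyp_laplacian_cmult[OF 3, of "-2"]]
  have ln: "ln (x * y / z\<^sup>2) = ln (x - 0) + ln (0 - y) + (- 2) * ln z"
    if "x \<noteq> 0" "y \<noteq> 0" "z \<noteq> 0" for x y z :: real
    using that by (simp add: ln_mult ln_div power2_eq_square ln_minus)
  show ?thesis
  proof (rule has_hyp_laplacian_cong[OF L U])
    fix p assume "p \<in> U"
    then obtain u v where p: "p = (u, v)" and uv: "(u, v) \<in> U"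
      by (cases p) auto
    show "ln (liouville_solution f g p) =
        (case p of (u, v) \<Rightarrow> ln (deriv f (u + v) - 0)) + (case p of (u, v) \<Rightarrow> ln (0 - deriv g (u - v))) +
        (- 2) * (case p of (u, v) \<Rightarrow> ln (f (u + v) - g (u - v)))"
      unfolding p liouville_solution_def prod.case by (rule ln[OF f0[OF uv] g0[OF uv] nz[OF uv]])
  next
    fix p
    show "- 8 * liouville_solution f g p =
        (case p of (u, v) \<Rightarrow> 4 * deriv (deriv f) (u + v) * 0 / (deriv f (u + v) - 0)\<^sup>2) +
        (case p of (u, v) \<Rightarrow> 4 * 0 * deriv (deriv g) (u - v) / (0 - deriv g (u - v))\<^sup>2) +
        (- 2) * (case p of (u, v) \<Rightarrow> 4 * deriv f (u + v) * deriv g (u - v) / (f (u + v) - g (u - v))\<^sup>2)"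
      by (cases p) (simp add: liouville_solution_def)
  qed
qed

lemma Ck_on_liouville_solution:
  assumes "smooth_on f I" and "smooth_on g J"
    and IJ: "\<And>u v. (u, v) \<in> U \<Longrightarrow> u + v \<in> I \<and> u - v \<in> J"
    and nz: "\<And>u v. (u, v) \<in> U \<Longrightarrow> f (u + v) - g (u - v) \<noteq> 0"
  shows "Ck_on n (liouville_solution f g) U"
proof -
  have wf: "Ck_on n (\<lambda>(u, v). F (u + v)) U" if "smooth_on F I" for F
    using Ck_on_wave[of U 1 I F n] that IJ by simp
  have wg: "Ck_on n (\<lambda>(u, v). G (u - v)) U" if "smooth_on G J" for G
    using Ck_on_wave[of U "-1" J G n] that IJ by simp
  let ?D = "\<lambda>(u, v). f (u + v) - g (u - v)"
  have D: "Ck_on n ?D U"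
    using Ck_on_diff[OF wf[OF assms(1)] wg[OF assms(2)]] by (simp add: case_prod_unfold)
  have "?D p * ?D p \<noteq> 0" if "p \<in> U" for p
    using nz that by (cases p) auto
  from Ck_on_divide[OF Ck_on_mult[OF wf[OF smooth_on_deriv[OF assms(1)]] wg[OF smooth_on_deriv[OF assms(2)]]]
      Ck_on_mult[OF D D] this]
  show ?thesis
    by (simp add: liouville_solution_def case_prod_unfold power2_eq_square)
qed

section \<open>Two solutions of Liouville's equation solve the system\<close>

text \<open>Everything rests on \<open>(a + b)\<^sup>2 - (a - b)\<^sup>2 = 4 a b\<close> and on
  \<open>a + b \<plusminus> (a - b) \<in> {2 a, 2 b}\<close>. The logarithms are written as the linear combinations
  to which the linearity of the Laplacian applies.\<close>

lemma system_terms_of_two_densities: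
  fixes a b \<epsilon> :: real
  assumes ab: "a * b > 0" and ne: "a \<noteq> b" and \<epsilon>: "\<epsilon> = 1 \<or> \<epsilon> = -1"
    and K: "K = - 8 * (sqrt (a * b) * (a + b))" and \<kappa>: "\<kappa> = - 8 * (sqrt (a * b) * \<bar>a - b\<bar>)"
  shows "K\<^sup>2 - \<kappa>\<^sup>2 = 256 * (a * b)\<^sup>2"
    and "root 4 (K\<^sup>2 - \<kappa>\<^sup>2) = 4 * sqrt (a * b)"
    and "ln (K\<^sup>2 - \<kappa>\<^sup>2) = ln 256 + (2 * ln a + 2 * ln b)"
    and "(K + \<epsilon> * \<kappa>) / (K - \<epsilon> * \<kappa>) > 0"
    and "ln ((K + \<epsilon> * \<kappa>) / (K - \<epsilon> * \<kappa>)) = \<epsilon> * sgn (a - b) * (ln a + (- 1) * ln b)"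
proof -
  have s: "sqrt (a * b) > 0" "(sqrt (a * b))\<^sup>2 = a * b"
    using ab by auto
  have nz: "a \<noteq> 0" "b \<noteq> 0"
    using ab by auto
  have "K\<^sup>2 - \<kappa>\<^sup>2 = 64 * (sqrt (a * b))\<^sup>2 * ((a + b)\<^sup>2 - \<bar>a - b\<bar>\<^sup>2)"
    unfolding K \<kappa> by (simp only: power_mult_distrib) (simp add: algebra_simps)
  also have "\<dots> = 256 * (a * b)\<^sup>2"
    unfolding s(2) by (simp add: power2_eq_square algebra_simps)
  finally show sq: "K\<^sup>2 - \<kappa>\<^sup>2 = 256 * (a * b)\<^sup>2" .
  have "(4 * sqrt (a * b)) ^ 4 = 256 * ((sqrt (a * b))\<^sup>2)\<^sup>2"
    by (simp add: power_mult_distrib flip: power_mult)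
  then have "256 * (a * b)\<^sup>2 = (4 * sqrt (a * b)) ^ 4"
    unfolding s(2) by simp
  then show "root 4 (K\<^sup>2 - \<kappa>\<^sup>2) = 4 * sqrt (a * b)"
    unfolding sq using s(1) by (simp only: real_root_power_cancel)
  show "ln (K\<^sup>2 - \<kappa>\<^sup>2) = ln 256 + (2 * ln a + 2 * ln b)"
    unfolding sq using nz by (simp add: ln_mult power2_eq_square)
  have "(K + \<epsilon> * \<kappa>) / (K - \<epsilon> * \<kappa>) =
      (- 8 * sqrt (a * b) * (a + b + \<epsilon> * \<bar>a - b\<bar>)) / (- 8 * sqrt (a * b) * (a + b - \<epsilon> * \<bar>a - b\<bar>))"
    unfolding K \<kappa> by (simp add: algebra_simps)
  also have "\<dots> = (a + b + \<epsilon> * \<bar>a - b\<bar>) / (a + b - \<epsilon> * \<bar>a - b\<bar>)"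
    using s(1) by (subst mult_divide_mult_cancel_left) auto
  also have "\<dots> = (if \<epsilon> * sgn (a - b) = 1 then a / b else b / a)"
    using \<epsilon> ne ab by (auto simp: sgn_if abs_if zero_less_mult_iff)
  finally have r: "(K + \<epsilon> * \<kappa>) / (K - \<epsilon> * \<kappa>) =
      (if \<epsilon> * sgn (a - b) = 1 then a / b else b / a)" .
  show "(K + \<epsilon> * \<kappa>) / (K - \<epsilon> * \<kappa>) > 0"
    unfolding r using ab by (auto simp: zero_less_divide_iff zero_less_mult_iff)
  show "ln ((K + \<epsilon> * \<kappa>) / (K - \<epsilon> * \<kappa>)) = \<epsilon> * sgn (a - b) * (ln a + (- 1) * ln b)"
    unfolding r using nz \<epsilon> ne by (auto simp: ln_div sgn_if)
qed

text \<open>Up to a factor, the first equation of the system is the sum of the two Liouville equations, and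
  the second one is their difference, taken with the sign of \<open>\<epsilon> (a - b)\<close>.\<close>

lemma solves_system_if_liouville:
  fixes a b :: "real \<times> real \<Rightarrow> real"
  assumes U: "open U" and Ca: "Ck_on 2 a U" and Cb: "Ck_on 2 b U"
    and La: "has_hyp_laplacian (\<lambda>p. ln (a p)) (\<lambda>p. - 8 * a p) U"
    and Lb: "has_hyp_laplacian (\<lambda>p. ln (b p)) (\<lambda>p. - 8 * b p) U"
    and ab: "\<And>p. p \<in> U \<Longrightarrow> a p * b p > 0" and ne: "\<And>p. p \<in> U \<Longrightarrow> a p \<noteq> b p"
    and \<epsilon>: "\<epsilon> = 1 \<or> \<epsilon> = -1"
    and K: "\<And>p. p \<in> U \<Longrightarrow> K p = - 8 * (sqrt (a p * b p) * (a p + b p))"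
    and \<kappa>: "\<And>p. p \<in> U \<Longrightarrow> \<kappa> p = - 8 * (sqrt (a p * b p) * \<bar>a p - b p\<bar>)"
  shows "solves_system U \<epsilon> K \<kappa>"
proof -
  note id = system_terms_of_two_densities[OF ab ne \<epsilon> K \<kappa>]
  have "Ck_on 2 (\<lambda>p. - 8 * (sqrt (a p * b p) * (a p + b p))) U"
    by (intro Ck_on_mult Ck_on_const Ck_on_sqrt Ck_on_add Ca Cb ab)
  then have CK: "C2_on K U"
    using Ck_on_cong[OF _ U K] Ck_on_imp_C2_on[OF _ U, of 0] by (simp add: numeral_2_eq_2)
  have "Ck_on 2 (\<lambda>p. - 8 * (sqrt (a p * b p) * \<bar>a p - b p\<bar>)) U"
    using ne by (intro Ck_on_mult Ck_on_const Ck_on_sqrt Ck_on_abs Ck_on_diff Ca Cb ab) auto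
  then have C\<kappa>: "C2_on \<kappa> U"
    using Ck_on_cong[OF _ U \<kappa>] Ck_on_imp_C2_on[OF _ U, of 0] by (simp add: numeral_2_eq_2)
  have eq: "(K p)\<^sup>2 - (\<kappa> p)\<^sup>2 > 0 \<and> (K p + \<epsilon> * \<kappa> p) / (K p - \<epsilon> * \<kappa> p) > 0 \<and>
      root 4 ((K p)\<^sup>2 - (\<kappa> p)\<^sup>2) * hyp_laplacian (\<lambda>q. ln ((K q)\<^sup>2 - (\<kappa> q)\<^sup>2)) p = 8 * K p \<and>
      root 4 ((K p)\<^sup>2 - (\<kappa> p)\<^sup>2) *
        hyp_laplacian (\<lambda>q. ln ((K q + \<epsilon> * \<kappa> q) / (K q - \<epsilon> * \<kappa> q))) p = 4 * \<epsilon> * \<kappa> p"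
    if p: "p \<in> U" for p
  proof (intro conjI)
    have "a p \<noteq> 0" "b p \<noteq> 0"
      using ab[OF p] by auto
    then show "(K p)\<^sup>2 - (\<kappa> p)\<^sup>2 > 0"
      by (simp add: id(1)[OF p p p p])
    show "(K p + \<epsilon> * \<kappa> p) / (K p - \<epsilon> * \<kappa> p) > 0"
      by (rule id(4)[OF p p p p])
    have lap: "hyp_laplacian (\<lambda>q. ln ((K q)\<^sup>2 - (\<kappa> q)\<^sup>2)) p = 0 + (2 * (- 8 * a p) + 2 * (- 8 * b p))"
      by (rule hyp_laplacian_eqI[OF has_hyp_laplacian_add[OF has_hyp_laplacian_const[of "ln 256"]
            has_hyp_laplacian_add[OF has_hyp_laplacian_cmult[OF La, of 2] has_hyp_laplacian_cmult[OF Lb, of 2]]]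
            U order_refl id(3) p])
    show "root 4 ((K p)\<^sup>2 - (\<kappa> p)\<^sup>2) * hyp_laplacian (\<lambda>q. ln ((K q)\<^sup>2 - (\<kappa> q)\<^sup>2)) p = 8 * K p"
      unfolding id(2)[OF p p p p] lap by (simp add: K[OF p] algebra_simps)
    \<comment> \<open>The sign of \<open>a - b\<close> is constant on the neighbourhood \<open>V\<close> of \<open>p\<close>, so there the second logarithm
      is a linear combination with constant coefficients.\<close>
    define \<sigma> where "\<sigma> = \<epsilon> * sgn (a p - b p)"
    define V where "V = U \<inter> (\<lambda>q. (a q - b q) * (a p - b p)) -` {0<..}"
    have "continuous_on U (\<lambda>q. (a q - b q) * (a p - b p))"
      using Ca Cb by (intro continuous_intros) (auto dest: Ck_on_imp_continuous_on)
    then have V: "open V"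
      unfolding V_def using U by (rule continuous_open_preimage) simp
    have pV: "p \<in> V"
      using p ne[OF p] by (auto simp: V_def zero_less_mult_iff linorder_neq_iff)
    have "ln ((K q + \<epsilon> * \<kappa> q) / (K q - \<epsilon> * \<kappa> q)) = \<sigma> * (ln (a q) + (- 1) * ln (b q))"
      if "q \<in> V" for q
    proof -
      have q: "q \<in> U" and "sgn (a q - b q) = sgn (a p - b p)"
        using that by (auto simp: V_def sgn_if zero_less_mult_iff)
      then show ?thesis
        using id(5)[OF q q q q] by (simp add: \<sigma>_def)
    qed
    then have "hyp_laplacian (\<lambda>q. ln ((K q + \<epsilon> * \<kappa> q) / (K q - \<epsilon> * \<kappa> q))) p =
        \<sigma> * (- 8 * a p + (- 1) * (- 8 * b p))"
      by (intro hyp_laplacian_eqI[OF has_hyp_laplacian_cmult[OF has_hyp_laplacian_add[OF La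
            has_hyp_laplacian_cmult[OF Lb, of "-1"]], of \<sigma>] V _ _ pV]) (auto simp: V_def)
    also have "\<dots> = - 8 * (\<epsilon> * (sgn (a p - b p) * (a p - b p)))"
      by (simp add: \<sigma>_def algebra_simps)
    also have "sgn (a p - b p) * (a p - b p) = \<bar>a p - b p\<bar>"
      by (simp add: abs_sgn mult.commute)
    finally show "root 4 ((K p)\<^sup>2 - (\<kappa> p)\<^sup>2) *
        hyp_laplacian (\<lambda>q. ln ((K q + \<epsilon> * \<kappa> q) / (K q - \<epsilon> * \<kappa> q))) p = 4 * \<epsilon> * \<kappa> p"
      unfolding id(2)[OF p p p p] by (simp add: \<kappa>[OF p])
  qed
  then show ?thesis
    unfolding solves_system_def using CK C\<kappa> by blast
qed

text \<open>Links the symmetric form of \<open>K\<close> and \<open>\<kappa>\<close> in \<open>a\<close>, \<open>b\<close> with the quotients that define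
  \<^const>\<open>sol_K\<close> and \<^const>\<open>sol_kappa\<close>, for \<open>A = g1' g2'\<close>, \<open>B = h1' h2'\<close>, \<open>G = g1 - g2\<close> and
  \<open>H = h1 - h2\<close>. The assumption removes the absolute value in \<open>sqrt ((G H)\<^sup>2) = \<bar>G H\<bar>\<close>; for
  \<open>G H < 0\<close> the first identity would change its sign, and the second one would not.\<close>

lemma weighted_sums_eq_quotients:
  fixes A B G H :: real
  assumes "G * H > 0"
  defines "a \<equiv> A / G\<^sup>2" and "b \<equiv> B / H\<^sup>2"
  shows "sqrt (a * b) * (a + b) = sqrt (A * B) * (H\<^sup>2 * A + G\<^sup>2 * B) / (G ^ 3 * H ^ 3)"
    and "sqrt (a * b) * \<bar>a - b\<bar> = sqrt (A * B) * \<bar>(H\<^sup>2 * A - G\<^sup>2 * B) / (G ^ 3 * H ^ 3)\<bar>"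
proof -
  have nz: "G \<noteq> 0" "H \<noteq> 0"
    using assms(1) by auto
  have "a * b = A * B / (G * H)\<^sup>2"
    by (simp add: a_def b_def power_mult_distrib)
  then have s: "sqrt (a * b) = sqrt (A * B) / (G * H)"
    using assms(1) by (simp add: real_sqrt_divide)
  show "sqrt (a * b) * (a + b) = sqrt (A * B) * (H\<^sup>2 * A + G\<^sup>2 * B) / (G ^ 3 * H ^ 3)"
    unfolding s using nz by (simp add: a_def b_def field_simps power2_eq_square power3_eq_cube)
  have "\<bar>a - b\<bar> / (G * H) = \<bar>(a - b) / (G * H)\<bar>"
    using assms(1) by simp
  also have "(a - b) / (G * H) = (H\<^sup>2 * A - G\<^sup>2 * B) / (G ^ 3 * H ^ 3)"
    using nz by (simp add: a_def b_def field_simps power2_eq_square power3_eq_cube)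
  finally show "sqrt (a * b) * \<bar>a - b\<bar> = sqrt (A * B) * \<bar>(H\<^sup>2 * A - G\<^sup>2 * B) / (G ^ 3 * H ^ 3)\<bar>"
    unfolding s by (metis times_divide_eq_left times_divide_eq_right)
qed

theorem theorem4p4:
  fixes g1 h1 g2 h2 :: "real \<Rightarrow> real"
    and I J :: "real set"
    and U :: "(real \<times> real) set"
    and \<epsilon> :: real
  assumes "open I" and "open J"
    and "smooth_on g1 I" and "smooth_on h1 I"
    and "smooth_on g2 J" and "smooth_on h2 J"
    and "open U"
    and "\<And>u v. (u, v) \<in> U \<Longrightarrow> u + v \<in> I \<and> u - v \<in> J"
    and "\<And>u v. (u, v) \<in> U \<Longrightarrow>
           deriv g1 (u + v) * deriv g2 (u - v) * deriv h1 (u + v) * deriv h2 (u - v) > 0"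
    and "\<And>u v. (u, v) \<in> U \<Longrightarrow> g1 (u + v) - g2 (u - v) \<noteq> 0"
    and "\<And>u v. (u, v) \<in> U \<Longrightarrow> h1 (u + v) - h2 (u - v) \<noteq> 0"
    and "\<And>u v. (u, v) \<in> U \<Longrightarrow>
           (g1 (u + v) - g2 (u - v)) * (h1 (u + v) - h2 (u - v)) > 0"
    and "\<And>u v. (u, v) \<in> U \<Longrightarrow>
           (h1 (u + v) - h2 (u - v))\<^sup>2 * deriv g1 (u + v) * deriv g2 (u - v) \<noteq>
           (g1 (u + v) - g2 (u - v))\<^sup>2 * deriv h1 (u + v) * deriv h2 (u - v)"
    and "\<epsilon> = 1 \<or> \<epsilon> = -1"
  shows "solves_system U \<epsilon> (sol_K g1 h1 g2 h2) (sol_kappa g1 h1 g2 h2)"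
proof -
  note IJ = assms(8) and pos = assms(9) and G0 = assms(10) and H0 = assms(11)
  let ?a = "liouville_solution g1 g2" and ?b = "liouville_solution h1 h2"
  have d0: "deriv g1 (u + v) \<noteq> 0" "deriv g2 (u - v) \<noteq> 0" "deriv h1 (u + v) \<noteq> 0"
    "deriv h2 (u - v) \<noteq> 0" if "(u, v) \<in> U" for u v
    using pos[OF that] by auto
  show ?thesis
  proof (rule solves_system_if_liouville[OF \<open>open U\<close>, where a = ?a and b = ?b])
    show "Ck_on 2 ?a U"
      by (rule Ck_on_liouville_solution[OF assms(3,5) IJ G0])
    show "Ck_on 2 ?b U"
      by (rule Ck_on_liouville_solution[OF assms(4,6) IJ H0])
    show "has_hyp_laplacian (\<lambda>p. ln (?a p)) (\<lambda>p. - 8 * ?a p) U"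
      by (rule liouville_equation[OF assms(3,5) IJ d0(1,2) G0 \<open>open U\<close>])
    show "has_hyp_laplacian (\<lambda>p. ln (?b p)) (\<lambda>p. - 8 * ?b p) U"
      by (rule liouville_equation[OF assms(4,6) IJ d0(3,4) H0 \<open>open U\<close>])
  next
    fix p assume "p \<in> U"
    then obtain u v where p: "p = (u, v)" and uv: "(u, v) \<in> U"
      by (cases p) auto
    define A B G H where "A = deriv g1 (u + v) * deriv g2 (u - v)"
      and "B = deriv h1 (u + v) * deriv h2 (u - v)"
      and "G = g1 (u + v) - g2 (u - v)" and "H = h1 (u + v) - h2 (u - v)"
    note defs = this
    have a: "?a (u, v) = A / G\<^sup>2" and b: "?b (u, v) = B / H\<^sup>2"
      by (simp_all add: liouville_solution_def defs)
    have nz: "G \<noteq> 0" "H \<noteq> 0" and GH: "G * H > 0"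
      unfolding defs by (rule G0[OF uv] H0[OF uv] assms(12)[OF uv])+
    have AB: "A * B > 0"
      using pos[OF uv] by (simp only: defs mult_ac)
    have neq: "H\<^sup>2 * A \<noteq> G\<^sup>2 * B"
      using assms(13)[OF uv] by (simp only: defs mult.assoc not_False_eq_True)
    have sq: "deriv g1 (u + v) * deriv h1 (u + v) * deriv g2 (u - v) * deriv h2 (u - v) = A * B"
      by (simp only: defs mult_ac)
    show "?a p * ?b p > 0"
      unfolding p a b using AB nz by simp
    show "?a p \<noteq> ?b p"
      unfolding p a b using neq nz by (simp add: frac_eq_eq mult.commute)
    show "sol_K g1 h1 g2 h2 p = - 8 * (sqrt (?a p * ?b p) * (?a p + ?b p))"
      unfolding p a b weighted_sums_eq_quotients[OF GH] sol_K_def prod.case sq by (simp only: defs mult.assoc)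
    show "sol_kappa g1 h1 g2 h2 p = - 8 * (sqrt (?a p * ?b p) * \<bar>?a p - ?b p\<bar>)"
      unfolding p a b weighted_sums_eq_quotients[OF GH] sol_kappa_def prod.case sq by (simp only: defs mult.assoc)
  qed (rule assms(14))
qed

end
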